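(* Consider the continuous-time Markov process $(W(t),\xi(t))$ on $\mathcal W_p\times\{0,1\}^{\mathcal X}$ described in the context, with fixed $\gamma>0$. Assume: 1. $\sum_{x\in A}\alpha_x<\sum_{y\in N(A)}\beta_y$ for every nonempty $A\subseteq\mathcal X$; 2. $\nu^{on}_x>0$, $\nu^{off}_x>0$ and $\nu^{act}_x>0$ for every $x\in\mathcal X$; 3. $\{\mathcal M_{\bar x}(W,\xi)\}$ is an admissible family. Then $(W(t),\xi(t))$, restricted to $\mathcal W\times\{0,1\}^{\mathcal X}$, is an ergodic time-reversible Markov process whose unique invariant probability measure is $$\mu_\gamma(\xi,W)=Z_\gamma^{-1}\Big[\prod_{x:\,\xi_x=1}\nu_x^{on}\prod_{x:\,\xi_x=0}\nu_x^{off}\Big]e^{\gamma\Psi(W)},$$ where $Z_\gamma$ is the normalizing constant.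
   Context: **Model.** $\mathcal G=(\mathcal X,\mathcal E)$ is a finite directed graph; $N_x=\{y:(x,y)\in\mathcal E\}$, $N(D)=\bigcup_{x\in D}N_x$. $\alpha,\beta$ are vectors of nonnegative integers indexed by $\mathcal X$. A partial allocation state is a matrix $W\in\mathbb N^{\mathcal X\times\mathcal X}$ (nonnegative integer entries) with $W_{xy}=0$ if $(x,y)\notin\mathcal E$; $W^x:=\sum_yW_{xy}\le\alpha_x$ for all $x$; $W_y:=\sum_xW_{xy}\le\beta_y$ for all $y$. $\mathcal W_p$ is the set of these, and $\mathcal W=\{W\in\mathcal W_p: W^x=\alpha_x\ \forall x\}$ is the set of allocation states. $\|W\|=\sum_{x,y}W_{xy}$. **Admissible families.** A functional state is $\xi\in\{0,1\}^{\mathcal X}$. $e_{xy}$ is the matrix with $1$ in position $(x,y)$ and $0$ elsewhere. For $W\in\mathcal W_p$, $\xi$, and $\bar x$ with $\xi_{\bar x}=1$, let $$\mathcal W_{\bar x}(W,\xi)=\{W'\in\mathcal W_p: W'\ne W,\ W'^{\bar x}\ge W^{\bar x},\ W'_{xy}=W_{xy}\text{ whenever }x\ne\bar x\text{ or }\xi_y=0\},$$ $$N_{\bar x}(W,\xi)=\{y\in N_{\bar x}: W_y<\beta_y,\ \xi_y=1\}.$$ A family of subsets $\mathcal M_{\bar x}(W,\xi)\subseteq\mathcal W_{\bar x}(W,\xi)$ (for all $W\in\mathcal W_p$, $\xi$, and $\bar x$ with $\xi_{\bar x}=1$) is admissible if: (i) if $W^{\bar x}<\alpha_{\bar x}$ and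 $y\in N_{\bar x}(W,\xi)$, then there is an integer $n\ge1$ with $W+n e_{\bar xy}\in\mathcal M_{\bar x}(W,\xi)$; (ii) if $W_{\bar xy'}>0$, $\xi_{y'}=1$, $y''\in N_{\bar x}(W,\xi)$ and $y''\neq y'$, then $W+e_{\bar xy''}-e_{\bar xy'}\in\mathcal M_{\bar x}(W,\xi)$; (iii) for all $W,W'\in\mathcal W$: $W'\in\mathcal M_{\bar x}(W,\xi)$ iff $W\in\mathcal M_{\bar x}(W',\xi)$. **Potential and utilities.** $\Psi:\mathcal W_p\to\mathbb R$ has the form $\Psi(W)=\sum_xf_x(W_{x\cdot})+\sum_yg_y(W_{\cdot y})$, with $f_x,g_y$ real-valued functions of the $x$-th row and $y$-th column of $W$. The utilities $U_x:\mathcal W_p\to\mathbb R$ satisfy $U_{\bar x}(W')-U_{\bar x}(W)=\Psi(W')-\Psi(W)$ whenever $W,W'\in\mathcal W_p$ agree outside row $\bar x$ (for instance $U_x(W)=f_x(W_{x\cdot})+\sum_{y\in N_x}g_y(W_{\cdot y})$). **Process.** Fix $\gamma>0$ and rates $\nu_x^{on},\nu_x^{off},\nu_x^{act}\ge0$. Let $Z^{(W,\xi)}_{\bar x}=\sum_{\tilde W\in\mathcal M_{\bar x}(W,\xi)}e^{\gamma U_{\bar x}(\tilde W)}$ and $Z^{(W,W',\xi)}_{\bar x}=\max\{Z^{(W,\xi)}_{\bar x},Z^{(W',\xi)}_{\bar x}\}$. For $W'\in\mathcal M_{\bar x}(W,\xi)$ set $P^{(W,\xi)}_{\bar x}(W')=e^{\gamma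 U_{\bar x}(W')}/Z^{(W,\xi)}_{\bar x}$ if $\|W\|<\|W'\|$, and $P^{(W,\xi)}_{\bar x}(W')=e^{\gamma U_{\bar x}(W')}/Z^{(W,W',\xi)}_{\bar x}$ if $\|W\|=\|W'\|$ (the remaining probability is assigned to staying at $W$). $(W(t),\xi(t))$ is the continuous-time Markov chain on $\mathcal W_p\times\{0,1\}^{\mathcal X}$ whose only nonzero transition rates between distinct states are: from $(W,\xi)$ to $(W,\xi')$, where $\xi'$ differs from $\xi$ only at $\bar x$: rate $\nu^{on}_{\bar x}$ if $\xi_{\bar x}=0,\xi'_{\bar x}=1$, and rate $\nu^{off}_{\bar x}$ if $\xi_{\bar x}=1,\xi'_{\bar x}=0$; from $(W,\xi)$ to $(W',\xi)$, where $\xi_{\bar x}=1$ and $W'\in\mathcal M_{\bar x}(W,\xi)$: rate $\nu^{act}_{\bar x}P^{(W,\xi)}_{\bar x}(W')$. The set $\mathcal W\times\{0,1\}^{\mathcal X}$ is invariant for this process (once entered it is never left). Ergodic means irreducible on this finite set; time-reversible means satisfying detailed balance with respect to the invariant measure. *)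

theory Defs
  imports "HOL-Probability.Probability"
begin

section \<open>Finite continuous-time Markov chains\<close>

text \<open>
  A chain is given by its finite state space \<open>S\<close> and its jump rates \<open>q s s'\<close> between distinct
  states; diagonal values of \<open>q\<close> are never used.
\<close>

definition generator :: "'s set \<Rightarrow> ('s \<Rightarrow> 's \<Rightarrow> real) \<Rightarrow> 's \<Rightarrow> 's \<Rightarrow> real" where
  "generator S q s s' = (if s = s' then - (\<Sum>u\<in>S - {s}. q s u) else q s s')"

primrec generator_power :: "'s set \<Rightarrow> ('s \<Rightarrow> 's \<Rightarrow> real) \<Rightarrow> nat \<Rightarrow> 's \<Rightarrow> 's \<Rightarrow> real" where
  "generator_power S q 0 s s' = (if s = s' then 1 else 0)"
| "generator_power S q (Suc n) s s' = (\<Sum>u\<in>S. generator S q s u * generator_power S q n u s')"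

text \<open>The transition semigroup, i.e. the matrix exponential of \<open>t\<close> times the generator.\<close>

definition transition_prob :: "'s set \<Rightarrow> ('s \<Rightarrow> 's \<Rightarrow> real) \<Rightarrow> real \<Rightarrow> 's \<Rightarrow> 's \<Rightarrow> real" where
  "transition_prob S q t s s' = (\<Sum>n. t ^ n / fact n * generator_power S q n s s')"

definition invariant_pmf :: "'s set \<Rightarrow> ('s \<Rightarrow> 's \<Rightarrow> real) \<Rightarrow> 's pmf \<Rightarrow> bool" where
  "invariant_pmf S q \<mu> \<longleftrightarrow> set_pmf \<mu> \<subseteq> S \<and>
     (\<forall>t\<ge>0. \<forall>s'\<in>S. (\<Sum>s\<in>S. pmf \<mu> s * transition_prob S q t s s') = pmf \<mu> s')"

definition detailed_balance :: "'s set \<Rightarrow> ('s \<Rightarrow> 's \<Rightarrow> real) \<Rightarrow> 's pmf \<Rightarrow> bool" where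
  "detailed_balance S q \<mu> \<longleftrightarrow>
     (\<forall>s\<in>S. \<forall>s'\<in>S. s \<noteq> s' \<longrightarrow> pmf \<mu> s * q s s' = pmf \<mu> s' * q s' s)"

definition irreducible_chain :: "'s set \<Rightarrow> ('s \<Rightarrow> 's \<Rightarrow> real) \<Rightarrow> bool" where
  "irreducible_chain S q \<longleftrightarrow>
     (\<forall>s\<in>S. \<forall>s'\<in>S. (s, s') \<in> {(u, v). u \<in> S \<and> v \<in> S \<and> u \<noteq> v \<and> q u v > 0}\<^sup>*)"

text \<open>The chain on \<open>S\<close> never leaves the subset \<open>T\<close>, so it restricts to a chain on \<open>T\<close>.\<close>

definition closed_class :: "'s set \<Rightarrow> ('s \<Rightarrow> 's \<Rightarrow> real) \<Rightarrow> 's set \<Rightarrow> bool" where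
  "closed_class S q T \<longleftrightarrow> T \<subseteq> S \<and> (\<forall>s\<in>T. \<forall>s'\<in>S - T. q s s' = 0)"


section \<open>Allocation states\<close>

text \<open>
  The vertex set is the finite type \<open>'x\<close> and \<open>E\<close> is the edge relation, so that the
  out-neighbourhood of a set \<open>D\<close> is \<open>E `` D\<close>. A functional state is a map into \<^typ>\<open>bool\<close>,
  with \<^const>\<open>True\<close> for 1.
\<close>

type_synonym 'x alloc = "'x \<Rightarrow> 'x \<Rightarrow> nat"
type_synonym 'x functional = "'x \<Rightarrow> bool"
type_synonym 'x family = "'x \<Rightarrow> 'x alloc \<Rightarrow> 'x functional \<Rightarrow> 'x alloc set"

definition row_sum :: "'x::finite alloc \<Rightarrow> 'x \<Rightarrow> nat" where
  "row_sum W x = (\<Sum>y\<in>UNIV. W x y)"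

definition col_sum :: "'x::finite alloc \<Rightarrow> 'x \<Rightarrow> nat" where
  "col_sum W y = (\<Sum>x\<in>UNIV. W x y)"

definition total :: "'x::finite alloc \<Rightarrow> nat" where
  "total W = (\<Sum>x\<in>UNIV. \<Sum>y\<in>UNIV. W x y)"

definition unit_matrix :: "'x \<Rightarrow> 'x \<Rightarrow> 'x alloc" where
  "unit_matrix x y = (\<lambda>u v. if u = x \<and> v = y then 1 else 0)"

definition partial_allocs ::
    "('x::finite \<times> 'x) set \<Rightarrow> ('x \<Rightarrow> nat) \<Rightarrow> ('x \<Rightarrow> nat) \<Rightarrow> 'x alloc set" where
  "partial_allocs E \<alpha> \<beta> = {W. (\<forall>x y. (x, y) \<notin> E \<longrightarrow> W x y = 0) \<and>
     (\<forall>x. row_sum W x \<le> \<alpha> x) \<and> (\<forall>y. col_sum W y \<le> \<beta> y)}"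

definition allocs ::
    "('x::finite \<times> 'x) set \<Rightarrow> ('x \<Rightarrow> nat) \<Rightarrow> ('x \<Rightarrow> nat) \<Rightarrow> 'x alloc set" where
  "allocs E \<alpha> \<beta> = {W \<in> partial_allocs E \<alpha> \<beta>. \<forall>x. row_sum W x = \<alpha> x}"

definition moves :: "('x::finite \<times> 'x) set \<Rightarrow> ('x \<Rightarrow> nat) \<Rightarrow> ('x \<Rightarrow> nat) \<Rightarrow> 'x family" where
  "moves E \<alpha> \<beta> x W \<xi> = {W' \<in> partial_allocs E \<alpha> \<beta>. W' \<noteq> W \<and> row_sum W' x \<ge> row_sum W x \<and>
     (\<forall>u y. u \<noteq> x \<or> \<not> \<xi> y \<longrightarrow> W' u y = W u y)}"

definition available ::
    "('x::finite \<times> 'x) set \<Rightarrow> ('x \<Rightarrow> nat) \<Rightarrow> 'x \<Rightarrow> 'x alloc \<Rightarrow> 'x functional \<Rightarrow> 'x set" where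
  "available E \<beta> x W \<xi> = {y \<in> E `` {x}. col_sum W y < \<beta> y \<and> \<xi> y}"

text \<open>
  The subtraction below is on \<^typ>\<open>nat\<close>, but it never truncates, since \<open>W x y' > 0\<close>.
\<close>

definition admissible ::
    "('x::finite \<times> 'x) set \<Rightarrow> ('x \<Rightarrow> nat) \<Rightarrow> ('x \<Rightarrow> nat) \<Rightarrow> 'x family \<Rightarrow> bool" where
  "admissible E \<alpha> \<beta> M \<longleftrightarrow>
     (\<forall>W\<in>partial_allocs E \<alpha> \<beta>. \<forall>\<xi> x. \<xi> x \<longrightarrow> M x W \<xi> \<subseteq> moves E \<alpha> \<beta> x W \<xi>) \<and>
     (\<forall>W\<in>partial_allocs E \<alpha> \<beta>. \<forall>\<xi> x. \<xi> x \<longrightarrow> row_sum W x < \<alpha> x \<longrightarrow>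
        (\<forall>y\<in>available E \<beta> x W \<xi>. \<exists>n\<ge>1. (\<lambda>u v. W u v + n * unit_matrix x y u v) \<in> M x W \<xi>)) \<and>
     (\<forall>W\<in>partial_allocs E \<alpha> \<beta>. \<forall>\<xi> x. \<xi> x \<longrightarrow>
        (\<forall>y'. \<forall>y''\<in>available E \<beta> x W \<xi>. W x y' > 0 \<and> \<xi> y' \<and> y'' \<noteq> y' \<longrightarrow>
          (\<lambda>u v. W u v + unit_matrix x y'' u v - unit_matrix x y' u v) \<in> M x W \<xi>)) \<and>
     (\<forall>W\<in>allocs E \<alpha> \<beta>. \<forall>W'\<in>allocs E \<alpha> \<beta>. \<forall>\<xi> x. \<xi> x \<longrightarrow> (W' \<in> M x W \<xi> \<longleftrightarrow> W \<in> M x W' \<xi>))"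

definition separable_potential ::
    "('x::finite \<times> 'x) set \<Rightarrow> ('x \<Rightarrow> nat) \<Rightarrow> ('x \<Rightarrow> nat) \<Rightarrow> ('x alloc \<Rightarrow> real) \<Rightarrow> bool" where
  "separable_potential E \<alpha> \<beta> \<Psi> \<longleftrightarrow>
     (\<exists>(f :: 'x \<Rightarrow> ('x \<Rightarrow> nat) \<Rightarrow> real) (g :: 'x \<Rightarrow> ('x \<Rightarrow> nat) \<Rightarrow> real).
        \<forall>W\<in>partial_allocs E \<alpha> \<beta>.
          \<Psi> W = (\<Sum>x\<in>UNIV. f x (\<lambda>y. W x y)) + (\<Sum>y\<in>UNIV. g y (\<lambda>x. W x y)))"

definition potential_utilities ::
    "('x::finite \<times> 'x) set \<Rightarrow> ('x \<Rightarrow> nat) \<Rightarrow> ('x \<Rightarrow> nat) \<Rightarrow>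
     ('x alloc \<Rightarrow> real) \<Rightarrow> ('x \<Rightarrow> 'x alloc \<Rightarrow> real) \<Rightarrow> bool" where
  "potential_utilities E \<alpha> \<beta> \<Psi> U \<longleftrightarrow>
     (\<forall>x. \<forall>W\<in>partial_allocs E \<alpha> \<beta>. \<forall>W'\<in>partial_allocs E \<alpha> \<beta>.
        (\<forall>u y. u \<noteq> x \<longrightarrow> W' u y = W u y) \<longrightarrow> U x W' - U x W = \<Psi> W' - \<Psi> W)"


section \<open>The allocation process\<close>

definition Zsum ::
    "real \<Rightarrow> ('x \<Rightarrow> 'x alloc \<Rightarrow> real) \<Rightarrow> 'x family \<Rightarrow> 'x \<Rightarrow> 'x alloc \<Rightarrow> 'x functional \<Rightarrow> real" where
  "Zsum \<gamma> U M x W \<xi> = (\<Sum>V\<in>M x W \<xi>. exp (\<gamma> * U x V))"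

text \<open>
  Only used for \<open>W' \<in> M x W \<xi>\<close>; since then \<open>total W \<le> total W'\<close>, the last case covers exactly
  \<open>total W = total W'\<close>.
\<close>

definition move_prob ::
    "real \<Rightarrow> ('x::finite \<Rightarrow> 'x alloc \<Rightarrow> real) \<Rightarrow> 'x family \<Rightarrow>
     'x \<Rightarrow> 'x alloc \<Rightarrow> 'x functional \<Rightarrow> 'x alloc \<Rightarrow> real" where
  "move_prob \<gamma> U M x W \<xi> W' =
     (if total W < total W' then exp (\<gamma> * U x W') / Zsum \<gamma> U M x W \<xi>
      else exp (\<gamma> * U x W') / max (Zsum \<gamma> U M x W \<xi>) (Zsum \<gamma> U M x W' \<xi>))"

text \<open>
  Each of the two sums has at most one term between distinct states: the vertex \<open>x\<close> where
  \<open>\<xi>\<close> and \<open>\<xi>'\<close> differ, respectively the row \<open>x\<close> where \<open>W\<close> and \<open>W'\<close> differ.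
\<close>

definition rate ::
    "('x::finite \<Rightarrow> real) \<Rightarrow> ('x \<Rightarrow> real) \<Rightarrow> ('x \<Rightarrow> real) \<Rightarrow>
     real \<Rightarrow> ('x \<Rightarrow> 'x alloc \<Rightarrow> real) \<Rightarrow> 'x family \<Rightarrow>
     'x alloc \<times> 'x functional \<Rightarrow> 'x alloc \<times> 'x functional \<Rightarrow> real" where
  "rate \<nu>on \<nu>off \<nu>act \<gamma> U M = (\<lambda>(W, \<xi>) (W', \<xi>').
     if W' = W then (\<Sum>x | \<xi>' = \<xi>(x := \<not> \<xi> x). if \<xi> x then \<nu>off x else \<nu>on x)
     else if \<xi>' = \<xi> then (\<Sum>x | \<xi> x \<and> W' \<in> M x W \<xi>. \<nu>act x * move_prob \<gamma> U M x W \<xi> W')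
     else 0)"

definition gibbs_weight ::
    "('x::finite \<Rightarrow> real) \<Rightarrow> ('x \<Rightarrow> real) \<Rightarrow> real \<Rightarrow> ('x alloc \<Rightarrow> real) \<Rightarrow>
     'x alloc \<times> 'x functional \<Rightarrow> real" where
  "gibbs_weight \<nu>on \<nu>off \<gamma> \<Psi> = (\<lambda>(W, \<xi>).
     (\<Prod>x | \<xi> x. \<nu>on x) * (\<Prod>x | \<not> \<xi> x. \<nu>off x) * exp (\<gamma> * \<Psi> W))"

end

theory Submission
  imports Defs
begin

text \<open>
  Connectedness of the allocation states is the main point. Take two states \<open>W\<close>, \<open>W'\<close> whose
  \<open>\<ell>\<^sub>1\<close>-distance cannot be decreased by moves on either side. Every column in which they differ is
  then full in both, and this persists when the same shifts are applied to both. But the set of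
  columns in which such joint shifts can free a slot must meet the neighbourhood of every vertex:
  the vertices whose neighbourhoods it misses would violate the strict Hall condition, since all
  other columns are full and served by these vertices only. From a vertex that serves a column of
  discrepancy a slot could thus be freed in this column, so \<open>W = W'\<close>. The same argument on the
  diagonal shows that a partial allocation of maximal total is an allocation state.

  Detailed balance is a direct computation, and in a reversible irreducible chain the ratio of a
  stationary vector to the reversible weight is harmonic, hence constant by the maximum principle. The derivative at \<open>t = 0\<close>
  of the semigroup links invariance with stationarity.
\<close>

section \<open>Reversible finite chains\<close>

text \<open>The constant adds up all entries of the generator in absolute value, so it dominates
  each row, and one more factor of the generator costs one more factor of the constant. Hence the
  exponential series converges.\<close>

lemma generator_power_bound:
  assumes "finite S" "s \<in> S"
  shows "\<bar>generator_power S q n s s'\<bar> \<le> (\<Sum>u\<in>S. \<Sum>v\<in>S. \<bar>generator S q u v\<bar>) ^ n"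
  using assms(2)
proof (induction n arbitrary: s)
  case 0
  then show ?case by simp
next
  case (Suc n)
  let ?C = "\<Sum>u\<in>S. \<Sum>v\<in>S. \<bar>generator S q u v\<bar>"
  have "\<bar>generator_power S q (Suc n) s s'\<bar> \<le> (\<Sum>u\<in>S. \<bar>generator S q s u * generator_power S q n u s'\<bar>)"
    by (simp add: sum_abs)
  also have "\<dots> \<le> (\<Sum>u\<in>S. \<bar>generator S q s u\<bar> * ?C ^ n)"
    by (intro sum_mono) (auto simp: abs_mult intro!: mult_left_mono Suc.IH)
  also have "\<dots> = (\<Sum>u\<in>S. \<bar>generator S q s u\<bar>) * ?C ^ n"
    by (simp add: sum_distrib_right)
  also have "\<dots> \<le> ?C * ?C ^ n"
  proof (intro mult_right_mono)
    show "(\<Sum>u\<in>S. \<bar>generator S q s u\<bar>) \<le> ?C"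
      using Suc.prems assms(1) by (intro member_le_sum[of s S "\<lambda>u. \<Sum>v\<in>S. \<bar>generator S q u v\<bar>"]) (auto intro: sum_nonneg)
  qed (auto intro!: zero_le_power sum_nonneg)
  finally show ?case by simp
qed

lemma summable_transition_series:
  assumes "finite S" "s \<in> S"
  shows "summable (\<lambda>n. t ^ n / fact n * generator_power S q n s s')"
proof -
  define C where "C = (\<Sum>u\<in>S. \<Sum>v\<in>S. \<bar>generator S q u v\<bar>)"
  have "norm (t ^ n / fact n * generator_power S q n s s') \<le> inverse (fact n) * (\<bar>t\<bar> * C) ^ n" for n
  proof -
    have "norm (t ^ n / fact n * generator_power S q n s s')
        = \<bar>t\<bar> ^ n / fact n * \<bar>generator_power S q n s s'\<bar>"
      by (simp add: abs_mult power_abs)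
    also have "\<dots> \<le> \<bar>t\<bar> ^ n / fact n * C ^ n"
      unfolding C_def by (intro mult_left_mono generator_power_bound assms) auto
    also have "\<dots> = inverse (fact n) * (\<bar>t\<bar> * C) ^ n"
      by (simp add: power_mult_distrib field_simps)
    finally show ?thesis .
  qed
  then show ?thesis
    by (intro summable_comparison_test'[OF summable_exp]) auto
qed

lemma sums_transition_prob:
  assumes "finite S"
  shows "(\<lambda>n. t ^ n / fact n * (\<Sum>s\<in>S. p s * generator_power S q n s s')) sums
    (\<Sum>s\<in>S. p s * transition_prob S q t s s')"
proof -
  have "(\<lambda>n. \<Sum>s\<in>S. p s * (t ^ n / fact n * generator_power S q n s s')) sums
      (\<Sum>s\<in>S. p s * transition_prob S q t s s')"
    unfolding transition_prob_def
    by (intro sums_sum sums_mult summable_sums summable_transition_series assms)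
  then show ?thesis
    by (simp add: sum_distrib_left mult_ac)
qed

text \<open>Stationarity kills every power of the generator but the zeroth, so only the constant
  term of the series survives.\<close>

lemma invariant_if_stationary:
  assumes "finite S" and "s' \<in> S"
    and stat: "\<And>u. u \<in> S \<Longrightarrow> (\<Sum>s\<in>S. p s * generator S q s u) = 0"
  shows "(\<Sum>s\<in>S. p s * transition_prob S q t s s') = p s'"
proof -
  have zero: "(\<Sum>s\<in>S. p s * generator_power S q (Suc n) s s') = 0" for n
  proof -
    have "(\<Sum>s\<in>S. p s * generator_power S q (Suc n) s s')
        = (\<Sum>s\<in>S. \<Sum>u\<in>S. p s * generator S q s u * generator_power S q n u s')"
      by (simp add: sum_distrib_left mult_ac)
    also have "\<dots> = (\<Sum>u\<in>S. (\<Sum>s\<in>S. p s * generator S q s u) * generator_power S q n u s')"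
      by (subst sum.swap) (simp add: sum_distrib_right)
    also have "\<dots> = 0" by (simp add: stat)
    finally show ?thesis .
  qed
  have "(\<lambda>n. t ^ n / fact n * (\<Sum>s\<in>S. p s * generator_power S q n s s')) sums
      (\<Sum>n\<in>{0}. t ^ n / fact n * (\<Sum>s\<in>S. p s * generator_power S q n s s'))"
  proof (rule sums_finite)
    fix n :: nat assume "n \<notin> {0}"
    then obtain m where "n = Suc m" by (cases n) auto
    then show "t ^ n / fact n * (\<Sum>s\<in>S. p s * generator_power S q n s s') = 0"
      using zero by simp
  qed simp
  with sums_transition_prob[OF assms(1)]
  have "(\<Sum>s\<in>S. p s * transition_prob S q t s s')
      = (\<Sum>n\<in>{0}. t ^ n / fact n * (\<Sum>s\<in>S. p s * generator_power S q n s s'))"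
    by (rule sums_unique2)
  then show ?thesis
    using assms(1,2) by (simp add: if_distrib[of "\<lambda>z. _ * z"] cong: if_cong)
qed

text \<open>For \<open>t > 0\<close> the series without its constant term vanishes. Dividing by
  \<open>t\<close> and letting \<open>t\<close> tend to 0 leaves the linear coefficient, the entry
  at \<open>u\<close> of \<open>p\<close> times the generator.\<close>

lemma stationary_if_invariant:
  assumes "finite S" and "u \<in> S"
    and inv: "\<And>t. t \<ge> 0 \<Longrightarrow> (\<Sum>s\<in>S. p s * transition_prob S q t s u) = p u"
  shows "(\<Sum>s\<in>S. p s * generator S q s u) = 0"
proof -
  define a where "a n = (\<Sum>s\<in>S. p s * generator_power S q n s u) / fact n" for n
  have a0: "a 0 = p u"
    using assms(1,2) by (simp add: a_def if_distrib[of "\<lambda>z. _ * z"] cong: if_cong)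
  have "(\<Sum>v\<in>S. generator S q s v * (if v = u then 1 else 0)) = generator S q s u" for s
    using assms(1,2) by (simp add: if_distrib[of "\<lambda>z. _ * z"] cong: if_cong)
  then have a1: "a 1 = (\<Sum>s\<in>S. p s * generator S q s u)"
    by (simp add: a_def)
  have sums: "(\<lambda>n. a n * t ^ n) sums (\<Sum>s\<in>S. p s * transition_prob S q t s u)" for t
    using sums_transition_prob[OF assms(1), of t p q u] by (simp add: a_def mult.commute)
  have tail: "(\<lambda>n. a (Suc n) * t ^ n) sums 0" if "t > 0" for t
  proof -
    have "(\<lambda>n. a n * t ^ n) sums a 0"
      using sums[of t] inv[of t] that a0 by simp
    then have "(\<lambda>n. t * (a (Suc n) * t ^ n)) sums 0"
      using sums_Suc_iff[of "\<lambda>n. a n * t ^ n" 0] by (simp add: mult_ac)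
    then show ?thesis
      using that sums_mult_iff[of t "\<lambda>n. a (Suc n) * t ^ n" 0] by simp
  qed
  \<comment> \<open>\<open>powser_limit_0\<close> wants a function represented by the series on both
    sides of 0. Invariance speaks of \<open>t \<ge> 0\<close> only, so for \<open>t \<le> 0\<close>
    the value of the series itself is taken.\<close>
  define g where "g t = (if t > 0 then 0 else (\<Sum>n. a (Suc n) * t ^ n))" for t :: real
  have "summable (\<lambda>n. a (Suc n) * t ^ n)" for t
  proof (cases "t = 0")
    case False
    have "summable (\<lambda>n. a (Suc n) * t ^ Suc n)"
      using sums[of t] by (subst summable_Suc_iff) (auto simp: sums_iff)
    then have "summable (\<lambda>n. t * (a (Suc n) * t ^ n))" by (simp add: mult_ac)
    then show ?thesis using False by (simp add: summable_cmult_iff)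
  qed auto
  then have "(\<lambda>n. a (Suc n) * t ^ n) sums g t" for t
    using tail[of t] by (auto simp: g_def summable_sums)
  then have "(g \<longlongrightarrow> a (Suc 0)) (at 0)"
    by (intro powser_limit_0[of 1]) auto
  then have "(g \<longlongrightarrow> a (Suc 0)) (at_right 0)"
    by (rule filterlim_mono) (auto simp: at_le)
  moreover have "(g \<longlongrightarrow> 0) (at_right 0)"
    by (rule tendsto_eventually) (auto simp: g_def eventually_at_filter)
  ultimately have "a (Suc 0) = 0"
    by (rule tendsto_unique[rotated]) simp
  with a1 show ?thesis by simp
qed

section \<open>Reversibility and uniqueness of the invariant measure\<close>

text \<open>Turns stationarity into a balance of flows, which detailed balance cancels summand by
  summand.\<close>

lemma sum_generator_eq_net_flow:
  assumes "finite S" and "u \<in> S"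
  shows "(\<Sum>s\<in>S. p s * generator S q s u) = (\<Sum>s\<in>S - {u}. p s * q s u - p u * q u s)"
proof -
  have "(\<Sum>s\<in>S. p s * generator S q s u)
      = p u * generator S q u u + (\<Sum>s\<in>S - {u}. p s * generator S q s u)"
    using assms by (rule sum.remove)
  also have "(\<Sum>s\<in>S - {u}. p s * generator S q s u) = (\<Sum>s\<in>S - {u}. p s * q s u)"
    by (intro sum.cong) (auto simp: generator_def)
  finally show ?thesis
    by (simp add: generator_def sum_subtractf sum_distrib_left)
qed

lemma stationary_proportional:
  assumes "finite S" "S \<noteq> {}"
    and q: "\<And>s s'. s \<in> S \<Longrightarrow> s' \<in> S \<Longrightarrow> s \<noteq> s' \<Longrightarrow> q s s' \<ge> 0"
    and w: "\<And>s. s \<in> S \<Longrightarrow> w s > 0"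
    and rev: "\<And>s s'. s \<in> S \<Longrightarrow> s' \<in> S \<Longrightarrow> s \<noteq> s' \<Longrightarrow> w s * q s s' = w s' * q s' s"
    and irr: "irreducible_chain S q"
    and stat: "\<And>u. u \<in> S \<Longrightarrow> (\<Sum>s\<in>S. p s * generator S q s u) = 0"
  shows "\<exists>c. \<forall>s\<in>S. p s = c * w s"
proof -
  define h where "h s = p s / w s" for s
  have p: "p s = h s * w s" if "s \<in> S" for s
    using w[OF that] by (simp add: h_def)
  obtain m where m: "m \<in> S" "\<And>s. s \<in> S \<Longrightarrow> h s \<le> h m"
    using Max_in[of "h ` S"] Max_ge[of "h ` S"] assms(1,2) by fastforce
  have step: "h v = h m" if "u \<in> S" "v \<in> S" "u \<noteq> v" "q u v > 0" "h u = h m" for u v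
  proof -
    \<comment> \<open>Reversibility expresses the flow from \<open>s\<close> into \<open>u\<close>
      by the rate out of \<open>u\<close>. As \<open>h\<close> is maximal at \<open>u\<close>, all
      summands then have the same sign, so each of them vanishes.\<close>
    have "p s * q s u - p u * q u s = - (w u * q u s * (h m - h s))" if "s \<in> S - {u}" for s
    proof -
      have "p s * q s u = h s * (w s * q s u)" using that p by simp
      also have "w s * q s u = w u * q u s" using that rev \<open>u \<in> S\<close> by auto
      finally show ?thesis using p[OF \<open>u \<in> S\<close>] \<open>h u = h m\<close> by (simp add: algebra_simps)
    qed
    then have sum0: "(\<Sum>s\<in>S - {u}. w u * q u s * (h m - h s)) = 0"
      using stat[OF \<open>u \<in> S\<close>] sum_generator_eq_net_flow[OF assms(1) \<open>u \<in> S\<close>, of p q]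
      by (simp add: sum_negf)
    have "w u * q u s * (h m - h s) \<ge> 0" if "s \<in> S - {u}" for s
      using that m w[of u] q[of u s] \<open>u \<in> S\<close> by (intro mult_nonneg_nonneg) (auto intro: less_imp_le)
    then have "w u * q u v * (h m - h v) = 0"
      using sum_nonneg_0[of "S - {u}" "\<lambda>s. w u * q u s * (h m - h s)" v] sum0 assms(1) that by simp
    then show ?thesis using w[OF \<open>u \<in> S\<close>] that by simp
  qed
  have "h s = h m" if "s \<in> S" for s
  proof -
    have "(m, s) \<in> {(u, v). u \<in> S \<and> v \<in> S \<and> u \<noteq> v \<and> q u v > 0}\<^sup>*"
      using irr m(1) that by (auto simp: irreducible_chain_def)
    then show ?thesis
      by (induction rule: rtrancl_induct) (auto intro: step)
  qed
  then have "\<forall>s\<in>S. p s = h m * w s" using p by simp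
  then show ?thesis ..
qed

theorem reversible_chain_unique_invariant:
  assumes "finite S" "S \<noteq> {}"
    and q: "\<And>s s'. s \<in> S \<Longrightarrow> s' \<in> S \<Longrightarrow> s \<noteq> s' \<Longrightarrow> q s s' \<ge> 0"
    and w: "\<And>s. s \<in> S \<Longrightarrow> w s > 0"
    and rev: "\<And>s s'. s \<in> S \<Longrightarrow> s' \<in> S \<Longrightarrow> s \<noteq> s' \<Longrightarrow> w s * q s s' = w s' * q s' s"
    and irr: "irreducible_chain S q"
  shows "\<exists>\<mu>. (\<forall>s\<in>S. pmf \<mu> s = w s / (\<Sum>s'\<in>S. w s')) \<and>
         (\<forall>\<pi>. invariant_pmf S q \<pi> \<longleftrightarrow> \<pi> = \<mu>) \<and> detailed_balance S q \<mu>"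
proof -
  define Z where "Z = (\<Sum>s\<in>S. w s)"
  have "Z > 0" unfolding Z_def using assms by (intro sum_pos) auto
  \<comment> \<open>\<open>embed_pmf\<close> needs a density on the whole type, hence the value 0
    outside \<open>S\<close>.\<close>
  define f where "f s = (if s \<in> S then w s / Z else 0)" for s
  have f0: "f s \<ge> 0" for s using w \<open>Z > 0\<close> by (auto simp: f_def intro: less_imp_le)
  have "(\<Sum>s\<in>S. f s) = 1"
    using \<open>Z > 0\<close> by (simp add: f_def Z_def sum_divide_distrib[symmetric])
  moreover have "(\<integral>\<^sup>+ s. ennreal (f s) \<partial>count_space UNIV) = (\<Sum>s\<in>S. ennreal (f s))"
    using assms(1) by (intro nn_integral_count_space'[of S]) (auto simp: f_def)
  ultimately have int: "(\<integral>\<^sup>+ s. ennreal (f s) \<partial>count_space UNIV) = 1"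
    using f0 by simp
  define \<mu> where "\<mu> = embed_pmf f"
  have \<mu>: "pmf \<mu> s = f s" for s
    unfolding \<mu>_def using f0 int by (rule pmf_embed_pmf)
  have set_\<mu>: "set_pmf \<mu> \<subseteq> S"
    by (auto simp: set_pmf_iff \<mu> f_def split: if_splits)
  have db: "f s * q s s' = f s' * q s' s" if "s \<in> S" "s' \<in> S" "s \<noteq> s'" for s s'
    using rev[OF that] that by (simp add: f_def)
  have stat: "(\<Sum>s\<in>S. f s * generator S q s u) = 0" if "u \<in> S" for u
    unfolding sum_generator_eq_net_flow[OF assms(1) that]
  proof (intro sum.neutral ballI)
    fix s assume "s \<in> S - {u}"
    then show "f s * q s u - f u * q u s = 0" using db[of s u] that by auto
  qed
  have "invariant_pmf S q \<pi> \<longleftrightarrow> \<pi> = \<mu>" for \<pi>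
  proof
    assume "\<pi> = \<mu>"
    then show "invariant_pmf S q \<pi>"
      using set_\<mu> invariant_if_stationary[OF assms(1) _ stat] by (simp add: invariant_pmf_def \<mu>)
  next
    assume inv: "invariant_pmf S q \<pi>"
    then have "(\<Sum>s\<in>S. pmf \<pi> s * generator S q s u) = 0" if "u \<in> S" for u
      using that by (intro stationary_if_invariant assms(1)) (auto simp: invariant_pmf_def)
    then have "\<exists>c. \<forall>s\<in>S. pmf \<pi> s = c * w s"
      by (intro stationary_proportional[of S q w "pmf \<pi>"] assms)
    then obtain c where c: "\<And>s. s \<in> S \<Longrightarrow> pmf \<pi> s = c * w s" by blast
    have "1 = (\<Sum>s\<in>S. pmf \<pi> s)"
      using inv assms(1) by (simp add: invariant_pmf_def sum_pmf_eq_1)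
    also have "\<dots> = c * Z" by (simp add: c Z_def sum_distrib_left)
    finally have "c = 1 / Z" using \<open>Z > 0\<close> by (simp add: field_simps)
    have "pmf \<pi> s = pmf \<mu> s" for s
    proof (cases "s \<in> S")
      case True
      then show ?thesis by (simp add: c \<mu> f_def \<open>c = 1 / Z\<close>)
    next
      case False
      then have "pmf \<pi> s = 0" using inv by (auto simp: invariant_pmf_def set_pmf_iff)
      with False show ?thesis by (simp add: \<mu> f_def)
    qed
    then show "\<pi> = \<mu>" by (rule pmf_eqI)
  qed
  moreover have "detailed_balance S q \<mu>"
    using db by (simp add: detailed_balance_def \<mu>)
  ultimately show ?thesis
    by (intro exI[of _ \<mu>]) (simp add: \<mu> f_def Z_def)
qed

section \<open>Shifting one unit within a row\<close>

text \<open>Has the shape of the matrix in the second closure condition of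
  \<open>admissible\<close>, so that folding \<open>shift_def\<close> there applies. The subtraction
  is exact when \<open>W x y > 0\<close>.\<close>

definition shift :: "'x \<Rightarrow> 'x \<Rightarrow> 'x \<Rightarrow> 'x alloc \<Rightarrow> 'x alloc" where
  "shift x y z W = (\<lambda>u v. W u v + unit_matrix x z u v - unit_matrix x y u v)"

lemma int_shift:
  assumes "W x y > 0" "y \<noteq> z"
  shows "int (shift x y z W u v) = int (W u v) + of_bool (u = x \<and> v = z) - of_bool (u = x \<and> v = y)"
  using assms by (auto simp: shift_def unit_matrix_def)

lemma shift_shift_back: "W x y > 0 \<Longrightarrow> y \<noteq> z \<Longrightarrow> shift x z y (shift x y z W) = W"
  by (auto simp: fun_eq_iff shift_def unit_matrix_def)

lemma shift_target_pos: "y \<noteq> z \<Longrightarrow> shift x y z W x z > 0"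
  by (simp add: shift_def unit_matrix_def)

lemma row_sum_shift:
  assumes "W x y > 0" "y \<noteq> z"
  shows "row_sum (shift x y z W) u = row_sum W u"
proof -
  have "int (row_sum (shift x y z W) u)
      = (\<Sum>v\<in>UNIV. int (W u v) + (if v = z then of_bool (u = x) else 0) - (if v = y then of_bool (u = x) else 0))"
    unfolding row_sum_def of_nat_sum using assms by (intro sum.cong) (auto simp: int_shift)
  also have "\<dots> = int (row_sum W u)"
    by (simp add: sum.distrib sum_subtractf row_sum_def)
  finally show ?thesis by linarith
qed

lemma col_sum_shift:
  assumes "W x y > 0" "y \<noteq> z"
  shows "int (col_sum (shift x y z W) v) = int (col_sum W v) + of_bool (v = z) - of_bool (v = y)"
proof -
  have "int (col_sum (shift x y z W) v)
      = (\<Sum>u\<in>UNIV. int (W u v) + (if u = x then of_bool (v = z) else 0) - (if u = x then of_bool (v = y) else 0))"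
    unfolding col_sum_def of_nat_sum using assms by (intro sum.cong) (auto simp: int_shift)
  also have "\<dots> = int (col_sum W v) + of_bool (v = z) - of_bool (v = y)"
    by (simp add: sum.distrib sum_subtractf col_sum_def)
  finally show ?thesis .
qed

text \<open>The source column has just lost a unit. This makes shifts reversible and lets free slots
  travel.\<close>

lemma col_sum_shift_source:
  assumes "W \<in> partial_allocs E \<alpha> \<beta>" "W x y > 0" "y \<noteq> z"
  shows "col_sum (shift x y z W) y < \<beta> y"
proof -
  have "col_sum W y \<le> \<beta> y" using assms(1) by (simp add: partial_allocs_def)
  then show ?thesis using col_sum_shift[of W x y z, OF assms(2,3), of y] assms(3) by simp
qed

lemma shift_partial_allocs:
  assumes W: "W \<in> partial_allocs E \<alpha> \<beta>" and "W x y > 0" "y \<noteq> z" and "(x, z) \<in> E" "col_sum W z < \<beta> z"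
  shows "shift x y z W \<in> partial_allocs E \<alpha> \<beta>"
proof -
  have "shift x y z W u v = 0" if "(u, v) \<notin> E" for u v
    using that W \<open>(x, z) \<in> E\<close> by (auto simp: shift_def unit_matrix_def partial_allocs_def)
  moreover have "col_sum (shift x y z W) v \<le> \<beta> v" for v
  proof -
    have "col_sum W v \<le> \<beta> v" using W by (simp add: partial_allocs_def)
    then show ?thesis
      using col_sum_shift[of W x y z, OF assms(2,3), of v] assms(5) by (cases "v = z"; cases "v = y") auto
  qed
  ultimately show ?thesis
    using W row_sum_shift[of W x y z, OF assms(2,3)] by (simp add: partial_allocs_def)
qed

lemma shift_allocs:
  assumes "W \<in> allocs E \<alpha> \<beta>" "W x y > 0" "y \<noteq> z" "(x, z) \<in> E" "col_sum W z < \<beta> z"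
  shows "shift x y z W \<in> allocs E \<alpha> \<beta>"
  using assms shift_partial_allocs row_sum_shift[of W x y z, OF assms(2,3)] by (fastforce simp: allocs_def)

lemma finite_partial_allocs: "finite (partial_allocs E \<alpha> \<beta>)"
proof (rule finite_subset)
  show "partial_allocs E \<alpha> \<beta> \<subseteq> (\<Pi>\<^sub>E x\<in>UNIV. \<Pi>\<^sub>E y\<in>UNIV. {..\<alpha> x})"
  proof
    fix W assume W: "W \<in> partial_allocs E \<alpha> \<beta>"
    have "W x y \<le> \<alpha> x" for x y
    proof -
      have "W x y \<le> row_sum W x" unfolding row_sum_def by (rule member_le_sum) auto
      also have "\<dots> \<le> \<alpha> x" using W by (simp add: partial_allocs_def)
      finally show ?thesis .
    qed
    then show "W \<in> (\<Pi>\<^sub>E x\<in>UNIV. \<Pi>\<^sub>E y\<in>UNIV. {..\<alpha> x})" by (auto simp: PiE_iff)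
  qed
  show "finite (\<Pi>\<^sub>E x\<in>(UNIV :: 'a set). \<Pi>\<^sub>E y\<in>(UNIV :: 'a set). {..\<alpha> x})"
    by (intro finite_PiE) auto
qed

section \<open>Freeing a slot\<close>

text \<open>
  Both components undergo the same shifts, so their entrywise difference never changes.
\<close>

inductive joint_reach ::
    "('x::finite \<times> 'x) set \<Rightarrow> ('x \<Rightarrow> nat) \<Rightarrow> 'x alloc \<Rightarrow> 'x alloc \<Rightarrow> 'x alloc \<Rightarrow> 'x alloc \<Rightarrow> bool"
  for E \<beta> V\<^sub>0 V\<^sub>0' where
  start: "joint_reach E \<beta> V\<^sub>0 V\<^sub>0' V\<^sub>0 V\<^sub>0'"
| step: "joint_reach E \<beta> V\<^sub>0 V\<^sub>0' (shift x y z V) (shift x y z V')"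
    if "joint_reach E \<beta> V\<^sub>0 V\<^sub>0' V V'" "V x y > 0" "V' x y > 0" "(x, z) \<in> E" "y \<noteq> z"
       "col_sum V z < \<beta> z" "col_sum V' z < \<beta> z"

lemma joint_reach_partial_allocs:
  assumes "joint_reach E \<beta> V\<^sub>0 V\<^sub>0' V V'" "V\<^sub>0 \<in> partial_allocs E \<alpha> \<beta>"
  shows "V \<in> partial_allocs E \<alpha> \<beta>"
  using assms by induction (auto intro: shift_partial_allocs)

lemma joint_reach_row_sum:
  assumes "joint_reach E \<beta> V\<^sub>0 V\<^sub>0' V V'"
  shows "row_sum V x = row_sum V\<^sub>0 x"
  using assms by induction (auto simp: row_sum_shift)

lemma joint_reach_diagonal:
  assumes "joint_reach E \<beta> V\<^sub>0 V\<^sub>0 V V'"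
  shows "V = V'"
  using assms by induction auto

text \<open>Only the first component is inspected: under \<open>lockstep\<close>, a slot into which
  the first component can shift is free in the second as well.\<close>

definition freeable ::
    "('x::finite \<times> 'x) set \<Rightarrow> ('x \<Rightarrow> nat) \<Rightarrow> 'x alloc \<Rightarrow> 'x alloc \<Rightarrow> 'x set" where
  "freeable E \<beta> V\<^sub>0 V\<^sub>0' = {z. \<exists>V V'. joint_reach E \<beta> V\<^sub>0 V\<^sub>0' V V' \<and> col_sum V z < \<beta> z}"

text \<open>The second component never blocks a shift of the first. Diagonal pairs and closest pairs
  both have this property, so the counting argument is done once for both.\<close>

definition lockstep ::
    "('x::finite \<times> 'x) set \<Rightarrow> ('x \<Rightarrow> nat) \<Rightarrow> 'x alloc \<Rightarrow> 'x alloc \<Rightarrow> bool" where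
  "lockstep E \<beta> V\<^sub>0 V\<^sub>0' \<longleftrightarrow>
     (\<forall>V V' x y z. joint_reach E \<beta> V\<^sub>0 V\<^sub>0' V V' \<longrightarrow> V x y > 0 \<longrightarrow> (x, z) \<in> E \<longrightarrow> y \<noteq> z \<longrightarrow>
        col_sum V z < \<beta> z \<longrightarrow> V' x y > 0 \<and> col_sum V' z < \<beta> z)"

text \<open>An entry can drop only by a shift out of its column, which leaves a free slot
  there.\<close>

lemma freeable_if_decreased:
  assumes "joint_reach E \<beta> V\<^sub>0 V\<^sub>0' V V'" "V\<^sub>0 \<in> partial_allocs E \<alpha> \<beta>" "V x y < V\<^sub>0 x y"
  shows "y \<in> freeable E \<beta> V\<^sub>0 V\<^sub>0'"
  using assms(1,3)
proof induction
  case start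
  then show ?case by simp
next
  case (step V V' x' y' z')
  show ?case
  proof (cases "V x y < V\<^sub>0 x y")
    case False
    \<comment> \<open>The entry falls below its start value only with this last shift, so this shift
      takes its unit from column \<open>y\<close>.\<close>
    then have "y = y'"
      using step by (auto simp: shift_def unit_matrix_def split: if_splits)
    then have "col_sum (shift x' y' z' V) y < \<beta> y"
      using col_sum_shift_source step joint_reach_partial_allocs assms(2) by metis
    then show ?thesis
      using joint_reach.step[OF step.hyps] by (auto simp: freeable_def)
  qed (use step in auto)
qed

text \<open>
  The unit to be shifted out of column \<open>y\<close> is either still there when \<open>z\<close> becomes free, or it has
  left \<open>y\<close> before and thereby freed a slot of \<open>y\<close>.
\<close>

lemma freeable_propagates:
  assumes V0: "V\<^sub>0 \<in> partial_allocs E \<alpha> \<beta>"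
    and lockstep: "lockstep E \<beta> V\<^sub>0 V\<^sub>0'"
    and "V\<^sub>0 x y > 0" "(x, z) \<in> E" "z \<in> freeable E \<beta> V\<^sub>0 V\<^sub>0'"
  shows "y \<in> freeable E \<beta> V\<^sub>0 V\<^sub>0'"
proof (cases "y = z")
  case False
  obtain V V' where V: "joint_reach E \<beta> V\<^sub>0 V\<^sub>0' V V'" "col_sum V z < \<beta> z"
    using assms(5) by (auto simp: freeable_def)
  show ?thesis
  proof (cases "V x y = 0")
    case True
    then show ?thesis using freeable_if_decreased[OF V(1) V0, of x y] assms(3) by simp
  next
    case pos: False
    then have "V' x y > 0" "col_sum V' z < \<beta> z"
      using lockstep V assms(4) False unfolding lockstep_def by blast+
    with pos have "joint_reach E \<beta> V\<^sub>0 V\<^sub>0' (shift x y z V) (shift x y z V')"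
      using V assms(4) False by (intro joint_reach.step) auto
    moreover have "col_sum (shift x y z V) y < \<beta> y"
      using col_sum_shift_source joint_reach_partial_allocs[OF V(1) V0] pos False by (metis gr0I)
    ultimately show ?thesis by (auto simp: freeable_def)
  qed
qed (use assms in simp)

lemma freeable_neighbour:
  assumes hall: "\<And>A. A \<noteq> {} \<Longrightarrow> (\<Sum>x\<in>A. \<alpha> x) < (\<Sum>y\<in>E `` A. \<beta> y)"
    and V0: "V\<^sub>0 \<in> partial_allocs E \<alpha> \<beta>"
    and lockstep: "lockstep E \<beta> V\<^sub>0 V\<^sub>0'"
  shows "\<exists>z\<in>freeable E \<beta> V\<^sub>0 V\<^sub>0'. (x, z) \<in> E"
proof (rule ccontr)
  assume contr: "\<not> ?thesis"
  define G where "G = freeable E \<beta> V\<^sub>0 V\<^sub>0'"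
  define A where "A = {x. \<forall>z\<in>G. (x, z) \<notin> E}"
  have "x \<in> A" using contr by (auto simp: A_def G_def)
  \<comment> \<open>The start pair is itself reachable, so a column with a free slot at the start
    lies in \<open>G\<close>.\<close>
  have full: "col_sum V\<^sub>0 y = \<beta> y" if "y \<notin> G" for y
  proof -
    have "\<not> col_sum V\<^sub>0 y < \<beta> y"
      using that joint_reach.start by (fastforce simp: G_def freeable_def)
    then show ?thesis using V0 by (simp add: partial_allocs_def nat_less_le)
  qed
  \<comment> \<open>A vertex outside \<open>A\<close> has an edge into \<open>G\<close>, so by
    propagation every column it serves lies in \<open>G\<close>.\<close>
  have zero: "V\<^sub>0 u y = 0" if "y \<notin> G" "u \<notin> A" for u y
    using that freeable_propagates[OF V0 lockstep] unfolding A_def G_def by blast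
  have "(\<Sum>y\<in>-G. \<beta> y) = (\<Sum>y\<in>-G. \<Sum>u\<in>UNIV. V\<^sub>0 u y)"
    using full by (intro sum.cong) (auto simp: col_sum_def)
  also have "\<dots> = (\<Sum>y\<in>-G. \<Sum>u\<in>A. V\<^sub>0 u y)"
    using zero by (intro sum.cong sum.mono_neutral_right) auto
  also have "\<dots> = (\<Sum>u\<in>A. \<Sum>y\<in>-G. V\<^sub>0 u y)"
    by (rule sum.swap)
  also have "\<dots> \<le> (\<Sum>u\<in>A. row_sum V\<^sub>0 u)"
    unfolding row_sum_def by (intro sum_mono sum_mono2) auto
  also have "\<dots> \<le> (\<Sum>u\<in>A. \<alpha> u)"
    using V0 by (intro sum_mono) (simp add: partial_allocs_def)
  also have "\<dots> < (\<Sum>y\<in>E `` A. \<beta> y)"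
    using \<open>x \<in> A\<close> by (intro hall) auto
  also have "\<dots> \<le> (\<Sum>y\<in>-G. \<beta> y)"
    by (intro sum_mono2) (auto simp: A_def)
  finally show False by simp
qed

section \<open>Existence of an allocation state\<close>

lemma allocs_nonempty:
  assumes hall: "\<And>A. A \<noteq> {} \<Longrightarrow> (\<Sum>x\<in>A. \<alpha> x) < (\<Sum>y\<in>E `` A. \<beta> y)"
  shows "allocs E \<alpha> \<beta> \<noteq> {}"
proof -
  let ?P = "partial_allocs E \<alpha> \<beta>"
  have "(\<lambda>_ _. 0) \<in> ?P" by (simp add: partial_allocs_def row_sum_def col_sum_def)
  then have "?P \<noteq> {}" by blast
  then obtain W where W: "W \<in> ?P" and max: "\<And>V. V \<in> ?P \<Longrightarrow> total V \<le> total W"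
    using Max_in[of "total ` ?P"] Max_ge[of "total ` ?P"] finite_partial_allocs[of E \<alpha> \<beta>] by fastforce
  have "row_sum W x = \<alpha> x" for x
  proof (rule ccontr)
    assume "row_sum W x \<noteq> \<alpha> x"
    then have less: "row_sum W x < \<alpha> x" using W by (simp add: partial_allocs_def nat_less_le)
    \<comment> \<open>On the diagonal the two components stay equal, so \<open>lockstep\<close> is
      immediate.\<close>
    have "\<exists>z\<in>freeable E \<beta> W W. (x, z) \<in> E"
      by (intro freeable_neighbour[OF hall W]) (auto simp: lockstep_def dest: joint_reach_diagonal)
    then obtain z V V' where z: "(x, z) \<in> E" and V: "joint_reach E \<beta> W W V V'" "col_sum V z < \<beta> z"
      by (auto simp: freeable_def)
    \<comment> \<open>The unit is added to \<open>V\<close>, where column \<open>z\<close> is open.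
      Shifts keep row sums, so row \<open>x\<close> is still short there, and the total exceeds the
      maximum.\<close>
    define V1 where "V1 u v = V u v + unit_matrix x z u v" for u v
    have VP: "V \<in> ?P" using joint_reach_partial_allocs[OF V(1) W] .
    have row: "row_sum V1 u = row_sum W u + (if u = x then 1 else 0)" for u
    proof -
      have "row_sum V1 u = (\<Sum>v\<in>UNIV. V u v + (if v = z then if u = x then 1 else 0 else 0))"
        unfolding row_sum_def V1_def by (intro sum.cong) (auto simp: unit_matrix_def)
      also have "\<dots> = row_sum V u + (if u = x then 1 else 0)"
        by (simp add: sum.distrib row_sum_def)
      finally show ?thesis using joint_reach_row_sum[OF V(1)] by simp
    qed
    have col: "col_sum V1 v = col_sum V v + (if v = z then 1 else 0)" for v
    proof -
      have "col_sum V1 v = (\<Sum>u\<in>UNIV. V u v + (if u = x then if v = z then 1 else 0 else 0))"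
        unfolding col_sum_def V1_def by (intro sum.cong) (auto simp: unit_matrix_def)
      also have "\<dots> = col_sum V v + (if v = z then 1 else 0)"
        by (simp add: sum.distrib col_sum_def)
      finally show ?thesis .
    qed
    have "V1 \<in> ?P"
      using VP z V(2) less W row col
      by (auto simp: partial_allocs_def V1_def unit_matrix_def Suc_le_eq)
    moreover have "total V1 = total W + 1"
    proof -
      have "total U = (\<Sum>u\<in>UNIV. row_sum U u)" for U :: "'a alloc"
        by (simp add: total_def row_sum_def)
      then show ?thesis by (simp add: row sum.distrib)
    qed
    ultimately show False using max by fastforce
  qed
  with W show ?thesis by (auto simp: allocs_def)
qed

section \<open>Connectedness of the allocation states\<close>

text \<open>With all vertices on, every admissible family contains these shifts, so connectedness
  under them serves all families.\<close>

definition shift_rel ::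
    "('x::finite \<times> 'x) set \<Rightarrow> ('x \<Rightarrow> nat) \<Rightarrow> ('x \<Rightarrow> nat) \<Rightarrow> 'x alloc rel" where
  "shift_rel E \<alpha> \<beta> = {(W, shift x y z W) | W x y z.
     W \<in> allocs E \<alpha> \<beta> \<and> W x y > 0 \<and> y \<noteq> z \<and> (x, z) \<in> E \<and> col_sum W z < \<beta> z}"

lemma shift_rel_allocs: "(W, W') \<in> shift_rel E \<alpha> \<beta> \<Longrightarrow> W' \<in> allocs E \<alpha> \<beta>"
  by (auto simp: shift_rel_def intro: shift_allocs)

lemma shift_rel_rtrancl_allocs:
  "(W, W') \<in> (shift_rel E \<alpha> \<beta>)\<^sup>* \<Longrightarrow> W \<in> allocs E \<alpha> \<beta> \<Longrightarrow> W' \<in> allocs E \<alpha> \<beta>"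
  by (induction rule: rtrancl_induct) (auto dest: shift_rel_allocs)

text \<open>The backward shift is allowed because the source column has been opened and, holding a
  unit before, is joined to \<open>x\<close> by an edge.\<close>

lemma sym_shift_rel: "sym (shift_rel E \<alpha> \<beta>)"
proof (rule symI)
  fix W W' assume "(W, W') \<in> shift_rel E \<alpha> \<beta>"
  then obtain x y z where W: "W \<in> allocs E \<alpha> \<beta>" "W x y > 0" "y \<noteq> z" "(x, z) \<in> E" "col_sum W z < \<beta> z"
    and W': "W' = shift x y z W"
    by (auto simp: shift_rel_def)
  have "(x, y) \<in> E" using W(1,2) by (fastforce simp: allocs_def partial_allocs_def)
  moreover have "W = shift x z y W'" using W W' by (simp add: shift_shift_back)
  moreover have "col_sum W' y < \<beta> y"
    using W W' col_sum_shift_source[of W E \<alpha> \<beta> x y z] by (simp add: allocs_def)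
  moreover have "W' \<in> allocs E \<alpha> \<beta>" using W W' shift_allocs by simp
  moreover have "W' x z > 0" using W W' shift_target_pos by simp
  ultimately show "(W', W) \<in> shift_rel E \<alpha> \<beta>" using W(3) unfolding shift_rel_def by blast
qed

section \<open>Distance and closest pairs\<close>

definition l1_dist :: "'x::finite alloc \<Rightarrow> 'x alloc \<Rightarrow> int" where
  "l1_dist W W' = (\<Sum>p\<in>UNIV. \<bar>int (W (fst p) (snd p)) - int (W' (fst p) (snd p))\<bar>)"

lemma l1_dist_commute: "l1_dist W W' = l1_dist W' W"
  by (simp add: l1_dist_def abs_minus_commute)

lemma l1_dist_shift_both:
  assumes "V x y > 0" "V' x y > 0" "y \<noteq> z"
  shows "l1_dist (shift x y z V) (shift x y z V') = l1_dist V V'"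
  unfolding l1_dist_def using assms by (intro sum.cong) (auto simp: int_shift)

text \<open>Leaving a surplus entry gains 1. The target entry costs at most 1, and gains another 1
  if it is in deficit.\<close>

lemma l1_dist_shift_le:
  assumes "W x y > W' x y" "y \<noteq> z"
  shows "l1_dist (shift x y z W) W' \<le> l1_dist W W'"
    and "W x z < W' x z \<Longrightarrow> l1_dist (shift x y z W) W' < l1_dist W W'"
proof -
  have pos: "W x y > 0" using assms(1) by simp
  define c :: int where "c = (if W x z < W' x z then - 1 else 1)"
  have "l1_dist (shift x y z W) W' \<le> (\<Sum>p\<in>UNIV. \<bar>int (W (fst p) (snd p)) - int (W' (fst p) (snd p))\<bar>
      + (if p = (x, z) then c else 0) + (if p = (x, y) then - 1 else 0))"
    unfolding l1_dist_def using assms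
    by (intro sum_mono) (auto simp: int_shift[of W x y z, OF pos assms(2)] c_def)
  also have "\<dots> = l1_dist W W' + c - 1"
    by (simp add: sum.distrib l1_dist_def)
  finally have *: "l1_dist (shift x y z W) W' \<le> l1_dist W W' + c - 1" .
  from * show "l1_dist (shift x y z W) W' \<le> l1_dist W W'" by (simp add: c_def split: if_splits)
  from * show "l1_dist (shift x y z W) W' < l1_dist W W'" if "W x z < W' x z"
    using that by (simp add: c_def)
qed

text \<open>The two sides move independently, and all reachable pairs compete rather than single
  shifts only; so minimality survives moves that do not increase the distance.\<close>

definition closest_pair ::
    "('x::finite \<times> 'x) set \<Rightarrow> ('x \<Rightarrow> nat) \<Rightarrow> ('x \<Rightarrow> nat) \<Rightarrow> 'x alloc \<Rightarrow> 'x alloc \<Rightarrow> bool" where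
  "closest_pair E \<alpha> \<beta> W W' \<longleftrightarrow> W \<in> allocs E \<alpha> \<beta> \<and> W' \<in> allocs E \<alpha> \<beta> \<and>
     (\<forall>V V'. (W, V) \<in> (shift_rel E \<alpha> \<beta>)\<^sup>* \<longrightarrow> (W', V') \<in> (shift_rel E \<alpha> \<beta>)\<^sup>* \<longrightarrow>
        l1_dist W W' \<le> l1_dist V V')"

lemma closest_pair_commute: "closest_pair E \<alpha> \<beta> W W' \<Longrightarrow> closest_pair E \<alpha> \<beta> W' W"
  unfolding closest_pair_def using l1_dist_commute by metis

lemma closest_pair_move:
  assumes "closest_pair E \<alpha> \<beta> W W'"
    and "(W, V) \<in> (shift_rel E \<alpha> \<beta>)\<^sup>*" "(W', V') \<in> (shift_rel E \<alpha> \<beta>)\<^sup>*"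
    and "l1_dist V V' \<le> l1_dist W W'"
  shows "closest_pair E \<alpha> \<beta> V V'"
  unfolding closest_pair_def
proof (intro conjI allI impI)
  fix U U' assume "(V, U) \<in> (shift_rel E \<alpha> \<beta>)\<^sup>*" "(V', U') \<in> (shift_rel E \<alpha> \<beta>)\<^sup>*"
  then have "(W, U) \<in> (shift_rel E \<alpha> \<beta>)\<^sup>*" "(W', U') \<in> (shift_rel E \<alpha> \<beta>)\<^sup>*"
    using assms(2,3) by (blast intro: rtrancl_trans)+
  then have "l1_dist W W' \<le> l1_dist U U'"
    using assms(1) unfolding closest_pair_def by blast
  then show "l1_dist V V' \<le> l1_dist U U'" using assms(4) by simp
qed (use assms shift_rel_rtrancl_allocs in \<open>auto simp: closest_pair_def\<close>)

lemma sum_eq_less_imp_greater: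
  fixes f g :: "'a \<Rightarrow> nat"
  assumes "finite A" "a \<in> A" "f a < g a" "sum g A \<le> sum f A"
  obtains b where "b \<in> A" "g b < f b"
proof (cases "\<forall>b\<in>A. f b \<le> g b")
  case True
  then have "sum f A < sum g A" using assms by (intro sum_strict_mono_ex1) auto
  with assms(4) show ?thesis by simp
next
  case False
  then show ?thesis using that by (auto simp: not_le)
qed

text \<open>Row sums agree, so a deficit at \<open>z\<close> comes with a surplus at some
  \<open>y\<close> of the same row. If column \<open>z\<close> were open, shifting from
  \<open>y\<close> to \<open>z\<close> would strictly reduce the distance.\<close>

lemma closest_pair_deficit_full:
  assumes c: "closest_pair E \<alpha> \<beta> W W'" and less: "W x z < W' x z"
  shows "col_sum W z = \<beta> z"
proof (rule ccontr)
  assume "col_sum W z \<noteq> \<beta> z"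
  moreover have W: "W \<in> allocs E \<alpha> \<beta>" "W' \<in> allocs E \<alpha> \<beta>" using c by (auto simp: closest_pair_def)
  ultimately have free: "col_sum W z < \<beta> z" by (simp add: allocs_def partial_allocs_def nat_less_le)
  have "row_sum W x = row_sum W' x" using W by (simp add: allocs_def)
  then obtain y where y: "W' x y < W x y"
    using sum_eq_less_imp_greater[of UNIV z "W x" "W' x"] less unfolding row_sum_def by auto
  have "y \<noteq> z" using y less by auto
  have "(x, z) \<in> E" using W(2) less by (fastforce simp: allocs_def partial_allocs_def)
  have "W x y > 0" using y by simp
  then have "(W, shift x y z W) \<in> shift_rel E \<alpha> \<beta>"
    using W(1) \<open>y \<noteq> z\<close> \<open>(x, z) \<in> E\<close> free unfolding shift_rel_def by blast
  then have "l1_dist W W' \<le> l1_dist (shift x y z W) W'"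
    using c unfolding closest_pair_def by blast
  then show False
    using l1_dist_shift_le(2)[of W' x y W z, OF y \<open>y \<noteq> z\<close> less] by simp
qed

text \<open>A deficit of one state fills its column. The other state cannot exceed this capacity, so
  it has a deficit in another row of the column, which is then full in it too.\<close>

lemma closest_pair_discrepancy_full:
  assumes c: "closest_pair E \<alpha> \<beta> W W'" and ne: "W x z \<noteq> W' x z"
  shows "col_sum W z = \<beta> z" "col_sum W' z = \<beta> z"
proof -
  have *: "col_sum V z = \<beta> z \<and> col_sum V' z = \<beta> z"
    if c: "closest_pair E \<alpha> \<beta> V V'" and less: "V x z < V' x z" for V V'
  proof
    show full: "col_sum V z = \<beta> z" using closest_pair_deficit_full that by blast
    have "col_sum V' z \<le> col_sum V z"
      using c full by (simp add: closest_pair_def allocs_def partial_allocs_def)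
    then obtain u where "V' u z < V u z"
      using sum_eq_less_imp_greater[of UNIV x "\<lambda>u. V u z" "\<lambda>u. V' u z"] less
      unfolding col_sum_def by auto
    then show "col_sum V' z = \<beta> z"
      using closest_pair_deficit_full[OF closest_pair_commute[OF c]] by blast
  qed
  show "col_sum W z = \<beta> z" "col_sum W' z = \<beta> z"
    using *[OF c] *[OF closest_pair_commute[OF c]] ne by (meson linorder_neqE_nat)+
qed

text \<open>Shifting a surplus from \<open>y\<close> to the open column \<open>z\<close> keeps the
  pair closest and opens column \<open>y\<close>. That column is full in \<open>W'\<close>, so the
  shifted state has a deficit in it, which would force it to be full.\<close>

lemma closest_pair_no_surplus:
  assumes c: "closest_pair E \<alpha> \<beta> W W'"
    and "col_sum W z < \<beta> z" "(x, z) \<in> E" "y \<noteq> z"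
  shows "W x y \<le> W' x y"
proof (rule ccontr)
  assume "\<not> ?thesis"
  then have gt: "W x y > W' x y" by simp
  let ?V = "shift x y z W"
  have W: "W \<in> allocs E \<alpha> \<beta>" "W' \<in> allocs E \<alpha> \<beta>" using c by (auto simp: closest_pair_def)
  have pos: "W x y > 0" using gt by simp
  then have "(W, ?V) \<in> shift_rel E \<alpha> \<beta>"
    using W(1) assms unfolding shift_rel_def by blast
  then have cV: "closest_pair E \<alpha> \<beta> ?V W'"
    using closest_pair_move[OF c] l1_dist_shift_le(1)[of W' x y W z, OF gt assms(4)] by blast
  have "col_sum ?V y < \<beta> y"
    using W pos assms(4) col_sum_shift_source[of W E \<alpha> \<beta> x y z] by (simp add: allocs_def)
  moreover have "col_sum W' y = \<beta> y"
    using closest_pair_discrepancy_full(2)[OF c, of x y] gt by simp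
  ultimately have "\<not> col_sum W' y \<le> col_sum ?V y" by simp
  then obtain u where "?V u y < W' u y"
    unfolding col_sum_def by (meson linorder_not_less sum_mono)
  then show False
    using closest_pair_deficit_full[OF cV] \<open>col_sum ?V y < \<beta> y\<close> by fastforce
qed

text \<open>An open column carries no discrepancy, so it is open on both sides, and neither side can
  have a surplus at \<open>(x, y)\<close>.\<close>

lemma closest_pair_lockstep:
  assumes c: "closest_pair E \<alpha> \<beta> W W'"
    and free: "col_sum W z < \<beta> z" and "(x, z) \<in> E" "y \<noteq> z"
  shows "W x y = W' x y" "col_sum W' z < \<beta> z"
proof -
  have "W u z = W' u z" for u
    using closest_pair_discrepancy_full(1)[OF c, of u z] free by fastforce
  then show free': "col_sum W' z < \<beta> z" using free by (simp add: col_sum_def)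
  show "W x y = W' x y"
    using closest_pair_no_surplus[OF c free assms(3,4)]
      closest_pair_no_surplus[OF closest_pair_commute[OF c] free' assms(3,4)] by simp
qed

text \<open>Joint shifts change no entrywise difference, so both the distance and the places of
  disagreement persist.\<close>

lemma joint_reach_closest_pair:
  assumes "joint_reach E \<beta> W W' V V'" "closest_pair E \<alpha> \<beta> W W'"
  shows "closest_pair E \<alpha> \<beta> V V' \<and> (V u v = V' u v \<longleftrightarrow> W u v = W' u v)"
  using assms
proof induction
  case (step V V' x y z)
  have "(V, shift x y z V) \<in> shift_rel E \<alpha> \<beta>" "(V', shift x y z V') \<in> shift_rel E \<alpha> \<beta>"
    using step unfolding shift_rel_def closest_pair_def by blast+
  then have "closest_pair E \<alpha> \<beta> (shift x y z V) (shift x y z V')"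
    using step.IH step.prems step.hyps l1_dist_shift_both[of V x y V' z]
    by (intro closest_pair_move[of E \<alpha> \<beta> V V' "shift x y z V" "shift x y z V'"] r_into_rtrancl) simp_all
  moreover have "shift x y z V u v = shift x y z V' u v \<longleftrightarrow> V u v = V' u v"
    using int_shift[of V x y z u v] int_shift[of V' x y z u v] step.hyps by linarith
  ultimately show ?case using step by simp
qed auto

lemma closest_pair_eq:
  assumes hall: "\<And>A. A \<noteq> {} \<Longrightarrow> (\<Sum>x\<in>A. \<alpha> x) < (\<Sum>y\<in>E `` A. \<beta> y)"
    and c: "closest_pair E \<alpha> \<beta> W W'"
  shows "W = W'"
proof (rule ccontr)
  assume "W \<noteq> W'"
  then obtain x y where ne: "W x y \<noteq> W' x y" by (auto simp: fun_eq_iff)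
  have W: "W \<in> partial_allocs E \<alpha> \<beta>" using c by (simp add: closest_pair_def allocs_def)
  have reach: "closest_pair E \<alpha> \<beta> V V' \<and> (V u v = V' u v \<longleftrightarrow> W u v = W' u v)"
    if "joint_reach E \<beta> W W' V V'" for V V' u v
    using joint_reach_closest_pair[OF that c] .
  have lockstep: "lockstep E \<beta> W W'"
    unfolding lockstep_def
  proof (intro allI impI)
    fix V V' x y z
    assume V: "joint_reach E \<beta> W W' V V'" and "0 < V x y" "(x, z) \<in> E" "y \<noteq> z" "col_sum V z < \<beta> z"
    then show "0 < V' x y \<and> col_sum V' z < \<beta> z"
      using closest_pair_lockstep[of E \<alpha> \<beta> V V' z x y] reach[OF V] by simp
  qed
  \<comment> \<open>The disagreement may come from a unit of \<open>W'\<close> alone. Equal column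
    sums ensure that \<open>W\<close> also has a unit in column \<open>y\<close>, possibly in
    another row \<open>x1\<close>.\<close>
  have "col_sum W y = col_sum W' y"
    using closest_pair_discrepancy_full[OF c ne] by simp
  moreover have "W x y \<le> col_sum W y" "W' x y \<le> col_sum W' y"
    unfolding col_sum_def by (rule member_le_sum; simp)+
  ultimately have "col_sum W y \<noteq> 0" using ne by linarith
  then obtain x1 where x1: "W x1 y > 0" by (auto simp: col_sum_def)
  obtain z where "z \<in> freeable E \<beta> W W'" "(x1, z) \<in> E"
    using freeable_neighbour[OF hall W lockstep] by blast
  then have "y \<in> freeable E \<beta> W W'"
    using freeable_propagates[OF W lockstep x1] by blast
  then obtain V V' where "joint_reach E \<beta> W W' V V'" "col_sum V y < \<beta> y"
    by (auto simp: freeable_def)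
  \<comment> \<open>The disagreement at \<open>(x, y)\<close> has persisted, so column
    \<open>y\<close> must still be full.\<close>
  then show False
    using reach[of V V' x y] closest_pair_discrepancy_full(1)[of E \<alpha> \<beta> V V' x y] ne by simp
qed

text \<open>Among the pairs reachable from both ends one of least distance is closest, hence a
  common state. Symmetry allows walking back from it to \<open>W'\<close>.\<close>

theorem allocs_connected:
  assumes hall: "\<And>A. A \<noteq> {} \<Longrightarrow> (\<Sum>x\<in>A. \<alpha> x) < (\<Sum>y\<in>E `` A. \<beta> y)"
    and W: "W \<in> allocs E \<alpha> \<beta>" "W' \<in> allocs E \<alpha> \<beta>"
  shows "(W, W') \<in> (shift_rel E \<alpha> \<beta>)\<^sup>*"
proof -
  let ?R = "(shift_rel E \<alpha> \<beta>)\<^sup>*"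
  define P where "P = (\<lambda>(V, V'). (W, V) \<in> ?R \<and> (W', V') \<in> ?R)"
  define d where "d = (\<lambda>(V, V'). nat (l1_dist V (V' :: 'a alloc)))"
  have "P (W, W')" by (simp add: P_def)
  then obtain p where "P p" "\<And>p'. P p' \<Longrightarrow> d p \<le> d p'"
    using ex_has_least_nat[of P _ d] by blast
  then obtain V V' where V: "(W, V) \<in> ?R" "(W', V') \<in> ?R"
    and least: "\<And>U U'. (W, U) \<in> ?R \<Longrightarrow> (W', U') \<in> ?R \<Longrightarrow> nat (l1_dist V V') \<le> nat (l1_dist U U')"
    by (cases p) (fastforce simp: P_def d_def)
  have "0 \<le> l1_dist U U'" for U U' :: "'a alloc"
    by (auto simp: l1_dist_def intro!: sum_nonneg)
  then have "l1_dist V V' \<le> l1_dist U U'" if "(V, U) \<in> ?R" "(V', U') \<in> ?R" for U U'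
    using least[of U U'] V that by (meson nat_le_eq_zle order_trans rtrancl_trans)
  then have "closest_pair E \<alpha> \<beta> V V'"
    using V W shift_rel_rtrancl_allocs unfolding closest_pair_def by blast
  then have "V = V'" using closest_pair_eq[OF hall] by blast
  moreover have "(V', W') \<in> ?R" using V(2) sym_rtrancl[OF sym_shift_rel] by (auto dest: symD)
  ultimately show ?thesis using V(1) by simp
qed

section \<open>The allocation process\<close>

lemma total_allocs: "W \<in> allocs E \<alpha> \<beta> \<Longrightarrow> total W = (\<Sum>x\<in>UNIV. \<alpha> x)"
  by (simp add: total_def allocs_def row_sum_def)

text \<open>A move never lowers the sum of its row, which is already at its bound.\<close>

lemma moves_allocs:
  assumes "W \<in> allocs E \<alpha> \<beta>" "W' \<in> moves E \<alpha> \<beta> x W \<xi>"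
  shows "W' \<in> allocs E \<alpha> \<beta>"
proof -
  have "row_sum W' u = \<alpha> u" for u
  proof (cases "u = x")
    case True
    have "row_sum W' x \<le> \<alpha> x" using assms(2) by (simp add: moves_def partial_allocs_def)
    moreover have "\<alpha> x \<le> row_sum W' x" using assms by (simp add: moves_def allocs_def)
    ultimately show ?thesis using True by simp
  next
    case False
    then have "row_sum W' u = row_sum W u" using assms(2) by (simp add: moves_def row_sum_def)
    then show ?thesis using assms(1) by (simp add: allocs_def)
  qed
  then show ?thesis using assms(2) by (simp add: moves_def allocs_def)
qed

text \<open>In either state the factor at \<open>x\<close> times the rate of flipping
  \<open>x\<close> is \<open>a x * b x\<close>; the other factors agree.\<close>

lemma prod_flip:
  fixes a b :: "'x::finite \<Rightarrow> real"
  assumes "\<xi>' = \<xi>(x := \<not> \<xi> x)"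
  shows "(\<Prod>u | \<xi> u. a u) * (\<Prod>u | \<not> \<xi> u. b u) * (if \<xi> x then b x else a x)
    = (\<Prod>u | \<xi>' u. a u) * (\<Prod>u | \<not> \<xi>' u. b u) * (if \<xi>' x then b x else a x)"
proof -
  define w where "w \<zeta> u = (if \<zeta> u then a u else b u)" for \<zeta> :: "'x \<Rightarrow> bool" and u
  have w: "(\<Prod>u | \<zeta> u. a u) * (\<Prod>u | \<not> \<zeta> u. b u) = w \<zeta> x * (\<Prod>u\<in>UNIV - {x}. w \<zeta> u)" for \<zeta>
  proof -
    have "(\<Prod>u | \<zeta> u. a u) * (\<Prod>u | \<not> \<zeta> u. b u) = (\<Prod>u\<in>UNIV. w \<zeta> u)"
      unfolding w_def by (subst prod.If_cases) (auto simp: Collect_neg_eq)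
    also have "\<dots> = w \<zeta> x * (\<Prod>u\<in>UNIV - {x}. w \<zeta> u)" by (rule prod.remove) auto
    finally show ?thesis .
  qed
  have "(\<Prod>u\<in>UNIV - {x}. w \<xi> u) = (\<Prod>u\<in>UNIV - {x}. w \<xi>' u)"
    using assms by (intro prod.cong) (auto simp: w_def)
  then show ?thesis
    unfolding w using assms by (auto simp: w_def)
qed

locale allocation_process =
  fixes E :: "('x::finite \<times> 'x) set"
    and \<alpha> \<beta> :: "'x \<Rightarrow> nat"
    and M :: "'x family"
    and \<Psi> :: "'x alloc \<Rightarrow> real"
    and U :: "'x \<Rightarrow> 'x alloc \<Rightarrow> real"
    and \<gamma> :: real
    and \<nu>on \<nu>off \<nu>act :: "'x \<Rightarrow> real"
  assumes potential: "potential_utilities E \<alpha> \<beta> \<Psi> U"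
    and hall: "A \<noteq> {} \<Longrightarrow> (\<Sum>x\<in>A. \<alpha> x) < (\<Sum>y\<in>E `` A. \<beta> y)"
    and on_pos: "\<nu>on x > 0" and off_pos: "\<nu>off x > 0" and act_pos: "\<nu>act x > 0"
    and admissible: "admissible E \<alpha> \<beta> M"
begin

abbreviation "states \<equiv> allocs E \<alpha> \<beta> \<times> (UNIV :: 'x functional set)"
abbreviation "q \<equiv> rate \<nu>on \<nu>off \<nu>act \<gamma> U M"
abbreviation "weight \<equiv> gibbs_weight \<nu>on \<nu>off \<gamma> \<Psi>"

lemma finite_states: "finite states"
  by (auto intro: finite_subset[OF _ finite_partial_allocs[of E \<alpha> \<beta>]] simp: allocs_def)

lemma allocs_partial: "W \<in> allocs E \<alpha> \<beta> \<Longrightarrow> W \<in> partial_allocs E \<alpha> \<beta>"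
  by (simp add: allocs_def)

lemma M_moves:
  assumes "W \<in> partial_allocs E \<alpha> \<beta>" "\<xi> x" "W' \<in> M x W \<xi>"
  shows "W' \<in> moves E \<alpha> \<beta> x W \<xi>"
  using admissible[unfolded admissible_def, THEN conjunct1] assms by blast

lemma M_sym:
  assumes "W \<in> allocs E \<alpha> \<beta>" "W' \<in> allocs E \<alpha> \<beta>" "\<xi> x"
  shows "W' \<in> M x W \<xi> \<longleftrightarrow> W \<in> M x W' \<xi>"
  using admissible[unfolded admissible_def, THEN conjunct2, THEN conjunct2, THEN conjunct2] assms by blast

lemma shift_in_M:
  assumes "W \<in> partial_allocs E \<alpha> \<beta>" "W x y > 0" "y \<noteq> z" "(x, z) \<in> E" "col_sum W z < \<beta> z"
  shows "shift x y z W \<in> M x W (\<lambda>_. True)"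
proof -
  have "z \<in> available E \<beta> x W (\<lambda>_. True)" using assms by (simp add: available_def)
  then show ?thesis
    using admissible[unfolded admissible_def, THEN conjunct2, THEN conjunct2, THEN conjunct1,
        folded shift_def, rule_format, OF assms(1), of "\<lambda>_. True" x z y] assms(2,3)
    by simp
qed

lemma closed_states: "closed_class (partial_allocs E \<alpha> \<beta> \<times> UNIV) q states"
  unfolding closed_class_def
proof (intro conjI ballI)
  fix s s' assume s: "s \<in> states" and s': "s' \<in> partial_allocs E \<alpha> \<beta> \<times> UNIV - states"
  obtain W \<xi> W' \<xi>' where [simp]: "s = (W, \<xi>)" "s' = (W', \<xi>')" by (cases s, cases s') auto
  have W: "W \<in> allocs E \<alpha> \<beta>" "W' \<notin> allocs E \<alpha> \<beta>" using s s' by auto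
  then have empty: "{x. \<xi> x \<and> W' \<in> M x W \<xi>} = {}"
    using M_moves moves_allocs allocs_partial by blast
  have "W' \<noteq> W" using W by auto
  then show "q s s' = 0" by (simp add: rate_def empty)
qed (auto simp: allocs_def)

section \<open>Positivity and detailed balance\<close>

lemma Zsum_pos:
  assumes "W \<in> partial_allocs E \<alpha> \<beta>" "\<xi> x" "W' \<in> M x W \<xi>"
  shows "Zsum \<gamma> U M x W \<xi> > 0"
  unfolding Zsum_def
proof (rule sum_pos)
  show "finite (M x W \<xi>)"
    using M_moves[of W \<xi> x, OF assms(1,2)] by (intro finite_subset[OF _ finite_partial_allocs[of E \<alpha> \<beta>]]) (auto simp: moves_def)
qed (use assms in auto)

lemma move_prob_pos:
  assumes "W \<in> partial_allocs E \<alpha> \<beta>" "\<xi> x" "W' \<in> M x W \<xi>"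
  shows "move_prob \<gamma> U M x W \<xi> W' > 0"
  using Zsum_pos[of W \<xi> x W'] assms by (simp add: move_prob_def less_max_iff_disj)

lemma rate_nonneg:
  assumes "s \<in> states"
  shows "q s s' \<ge> 0"
proof -
  obtain W \<xi> W' \<xi>' where [simp]: "s = (W, \<xi>)" "s' = (W', \<xi>')" by (cases s, cases s') auto
  have "W \<in> partial_allocs E \<alpha> \<beta>" using assms by (simp add: allocs_def)
  then show ?thesis
    using on_pos off_pos act_pos move_prob_pos
    by (auto simp: rate_def less_imp_le intro!: sum_nonneg mult_nonneg_nonneg)
qed

lemma weight_pos: "weight s > 0"
  using on_pos off_pos by (auto simp: gibbs_weight_def split: prod.split intro!: mult_pos_pos prod_pos)

text \<open>Allocation states share one total, so both directions use the symmetric denominator with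
  the maximum. The numerators match by the potential property.\<close>

lemma reversible_move:
  assumes W: "W \<in> allocs E \<alpha> \<beta>" "W' \<in> allocs E \<alpha> \<beta>" and x: "\<xi> x" "W' \<in> M x W \<xi>"
  shows "exp (\<gamma> * \<Psi> W) * move_prob \<gamma> U M x W \<xi> W' = exp (\<gamma> * \<Psi> W') * move_prob \<gamma> U M x W' \<xi> W"
proof -
  have "\<forall>u y. u \<noteq> x \<longrightarrow> W' u y = W u y"
    using M_moves[of W \<xi> x W', OF allocs_partial x] W by (auto simp: moves_def)
  then have "U x W' - U x W = \<Psi> W' - \<Psi> W"
    using potential W allocs_partial unfolding potential_utilities_def by blast
  then have "\<gamma> * \<Psi> W + \<gamma> * U x W' = \<gamma> * \<Psi> W' + \<gamma> * U x W"
    by (simp flip: distrib_left)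
  then have "exp (\<gamma> * \<Psi> W) * exp (\<gamma> * U x W') = exp (\<gamma> * \<Psi> W') * exp (\<gamma> * U x W)"
    by (simp flip: exp_add)
  then show ?thesis
    by (simp add: move_prob_def total_allocs[OF W(1)] total_allocs[OF W(2)] max.commute)
qed

lemma weight_reversible:
  assumes "s \<in> states" "s' \<in> states" "s \<noteq> s'"
  shows "weight s * q s s' = weight s' * q s' s"
proof -
  obtain W \<xi> W' \<xi>' where [simp]: "s = (W, \<xi>)" "s' = (W', \<xi>')" by (cases s, cases s') auto
  have W: "W \<in> allocs E \<alpha> \<beta>" "W' \<in> allocs E \<alpha> \<beta>" using assms by auto
  consider "W' = W" | "W' \<noteq> W" "\<xi>' = \<xi>" | "W' \<noteq> W" "\<xi>' \<noteq> \<xi>" by blast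
  then show ?thesis
  proof cases
    case 1
    have "{x. \<xi> = \<xi>'(x := \<not> \<xi>' x)} = {x. \<xi>' = \<xi>(x := \<not> \<xi> x)}"
      by (auto simp: fun_eq_iff split: if_splits)
    then have "weight s * q s s' = (\<Sum>x | \<xi>' = \<xi>(x := \<not> \<xi> x).
          weight (W, \<xi>) * (if \<xi> x then \<nu>off x else \<nu>on x))"
      and "weight s' * q s' s = (\<Sum>x | \<xi>' = \<xi>(x := \<not> \<xi> x).
          weight (W, \<xi>') * (if \<xi>' x then \<nu>off x else \<nu>on x))"
      using 1 by (simp_all add: rate_def sum_distrib_left)
    moreover have "weight (W, \<xi>) * (if \<xi> x then \<nu>off x else \<nu>on x)
        = weight (W, \<xi>') * (if \<xi>' x then \<nu>off x else \<nu>on x)" if "\<xi>' = \<xi>(x := \<not> \<xi> x)" for x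
    proof -
      have "exp (\<gamma> * \<Psi> W) * ((\<Prod>u | \<xi> u. \<nu>on u) * (\<Prod>u | \<not> \<xi> u. \<nu>off u) * (if \<xi> x then \<nu>off x else \<nu>on x))
        = exp (\<gamma> * \<Psi> W) * ((\<Prod>u | \<xi>' u. \<nu>on u) * (\<Prod>u | \<not> \<xi>' u. \<nu>off u) * (if \<xi>' x then \<nu>off x else \<nu>on x))"
        by (simp only: prod_flip[OF that])
      then show ?thesis by (simp only: gibbs_weight_def prod.case mult_ac)
    qed
    ultimately show ?thesis by simp
  next
    case 2
    \<comment> \<open>The symmetry condition of \<open>admissible\<close> makes the same vertices
      responsible for both directions.\<close>
    have "{x. \<xi> x \<and> W \<in> M x W' \<xi>} = {x. \<xi> x \<and> W' \<in> M x W \<xi>}"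
      using M_sym[OF W] by blast
    moreover have "weight (W, \<xi>) * (\<nu>act x * move_prob \<gamma> U M x W \<xi> W')
        = weight (W', \<xi>) * (\<nu>act x * move_prob \<gamma> U M x W' \<xi> W)"
      if "\<xi> x \<and> W' \<in> M x W \<xi>" for x
      using reversible_move[OF W, of \<xi> x] that by (simp add: gibbs_weight_def)
    ultimately show ?thesis
      using 2 by (auto simp: rate_def sum_distrib_left simp del: mult_cancel_left mult_cancel_right intro!: sum.cong)
  next
    case 3
    then show ?thesis by (auto simp: rate_def)
  qed
qed

section \<open>Irreducibility\<close>

abbreviation "jumps \<equiv> {(u, v). u \<in> states \<and> v \<in> states \<and> u \<noteq> v \<and> q u v > 0}"

lemma jump_flip:
  assumes W: "W \<in> allocs E \<alpha> \<beta>"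
  shows "((W, \<xi>), (W, \<xi>(x := b))) \<in> jumps\<^sup>*"
proof (cases "\<xi> x = b")
  case True
  then have "\<xi>(x := b) = \<xi>" by auto
  then show ?thesis by simp
next
  case False
  then have b: "b = (\<not> \<xi> x)" by auto
  define \<xi>' where "\<xi>' = \<xi>(x := b)"
  have "0 < (\<Sum>u | \<xi>' = \<xi>(u := \<not> \<xi> u). if \<xi> u then \<nu>off u else \<nu>on u)"
    using on_pos off_pos by (intro sum_pos) (auto simp: \<xi>'_def b)
  then have "q (W, \<xi>) (W, \<xi>') > 0" by (simp add: rate_def)
  moreover have "\<xi> \<noteq> \<xi>'" using False by (auto simp: \<xi>'_def fun_eq_iff)
  ultimately show ?thesis using W by (intro r_into_rtrancl) (simp add: \<xi>'_def)
qed

text \<open>Vertices are switched one at a time; \<open>A\<close> collects those already in their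
  final state.\<close>

lemma jump_functional:
  assumes W: "W \<in> allocs E \<alpha> \<beta>"
  shows "((W, \<xi>), (W, \<xi>')) \<in> jumps\<^sup>*"
proof -
  have "((W, \<xi>), (W, \<lambda>u. if u \<in> A then \<xi>' u else \<xi> u)) \<in> jumps\<^sup>*" if "finite A" for A
    using that
  proof induction
    case (insert a A)
    have "(\<lambda>u. if u \<in> insert a A then \<xi>' u else \<xi> u) = (\<lambda>u. if u \<in> A then \<xi>' u else \<xi> u)(a := \<xi>' a)"
      by (auto simp: fun_eq_iff)
    then show ?case
      using insert.IH jump_flip[OF W, of "\<lambda>u. if u \<in> A then \<xi>' u else \<xi> u" a "\<xi>' a"]
      by (metis (no_types, lifting) rtrancl_trans)
  qed simp
  from this[of UNIV] show ?thesis by simp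
qed

lemma jump_shift:
  assumes "(W, W') \<in> shift_rel E \<alpha> \<beta>"
  shows "((W, \<lambda>_. True), (W', \<lambda>_. True)) \<in> jumps"
proof -
  obtain x y z where W: "W \<in> allocs E \<alpha> \<beta>" "W x y > 0" "y \<noteq> z" "(x, z) \<in> E" "col_sum W z < \<beta> z"
    and W': "W' = shift x y z W"
    using assms by (auto simp: shift_rel_def)
  have M: "W' \<in> M x W (\<lambda>_. True)"
    using W shift_in_M allocs_partial by (simp add: W')
  then have ne: "W' \<noteq> W"
    using M_moves[OF allocs_partial[OF W(1)], of "\<lambda>_. True" x W'] by (simp add: moves_def)
  have "0 < (\<Sum>u | W' \<in> M u W (\<lambda>_. True). \<nu>act u * move_prob \<gamma> U M u W (\<lambda>_. True) W')"
    using act_pos move_prob_pos[OF allocs_partial[OF W(1)]] M by (intro sum_pos) auto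
  then have "q (W, \<lambda>_. True) (W', \<lambda>_. True) > 0"
    using ne by (simp add: rate_def)
  then show ?thesis using ne W(1) shift_rel_allocs[OF assms] by auto
qed

text \<open>Switch all vertices on, move the allocation by shifts, then switch to the target
  functional state.\<close>

lemma irreducible_states: "irreducible_chain states q"
  unfolding irreducible_chain_def
proof (intro ballI)
  fix s s' assume s: "s \<in> states" "s' \<in> states"
  obtain W \<xi> W' \<xi>' where [simp]: "s = (W, \<xi>)" "s' = (W', \<xi>')" by (cases s, cases s') auto
  have W: "W \<in> allocs E \<alpha> \<beta>" "W' \<in> allocs E \<alpha> \<beta>" using s by auto
  have "(W, W') \<in> (shift_rel E \<alpha> \<beta>)\<^sup>*" by (rule allocs_connected[OF hall W])
  then have "((W, \<lambda>_. True), (W', \<lambda>_. True)) \<in> jumps\<^sup>*"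
  proof induction
    case (step V V')
    then show ?case using jump_shift by (meson rtrancl.rtrancl_into_rtrancl)
  qed simp
  then show "(s, s') \<in> jumps\<^sup>*"
    using jump_functional[OF W(1), of \<xi> "\<lambda>_. True"] jump_functional[OF W(2), of "\<lambda>_. True" \<xi>']
    by (auto intro: rtrancl_trans)
qed

end

theorem corollary12:
  fixes E :: "('x::finite \<times> 'x) set"
    and \<alpha> \<beta> :: "'x \<Rightarrow> nat"
    and M :: "'x family"
    and \<Psi> :: "'x alloc \<Rightarrow> real"
    and U :: "'x \<Rightarrow> 'x alloc \<Rightarrow> real"
    and \<gamma> :: real
    and \<nu>on \<nu>off \<nu>act :: "'x \<Rightarrow> real"
  defines "S \<equiv> allocs E \<alpha> \<beta> \<times> (UNIV :: 'x functional set)"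
    and "q \<equiv> rate \<nu>on \<nu>off \<nu>act \<gamma> U M"
  assumes "\<gamma> > 0"
    and "separable_potential E \<alpha> \<beta> \<Psi>"
    and "potential_utilities E \<alpha> \<beta> \<Psi> U"
    and "\<And>A. A \<noteq> {} \<Longrightarrow> (\<Sum>x\<in>A. \<alpha> x) < (\<Sum>y\<in>E `` A. \<beta> y)"
    and "\<And>x. \<nu>on x > 0" and "\<And>x. \<nu>off x > 0" and "\<And>x. \<nu>act x > 0"
    and "admissible E \<alpha> \<beta> M"
  shows "closed_class (partial_allocs E \<alpha> \<beta> \<times> UNIV) q S \<and>
    irreducible_chain S q \<and>
    (\<exists>\<mu>. (\<forall>s\<in>S. pmf \<mu> s = gibbs_weight \<nu>on \<nu>off \<gamma> \<Psi> s / (\<Sum>s'\<in>S. gibbs_weight \<nu>on \<nu>off \<gamma> \<Psi> s')) \<and>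
         (\<forall>\<pi>. invariant_pmf S q \<pi> \<longleftrightarrow> \<pi> = \<mu>) \<and>
         detailed_balance S q \<mu>)"
proof -
  interpret allocation_process E \<alpha> \<beta> M \<Psi> U \<gamma> \<nu>on \<nu>off \<nu>act
    by unfold_locales (use assms in auto)
  have "states \<noteq> {}" using allocs_nonempty[OF hall] by simp
  then show ?thesis
    unfolding S_def q_def
    using closed_states irreducible_states
      reversible_chain_unique_invariant[OF finite_states _ rate_nonneg weight_pos weight_reversible]
    by simp
qed

end
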